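(* For every integer $r\geq 4$, every group $G$ of order $2^{r}\cdot 3\cdot 5$ satisfies $O_{2}(G)\neq 1$.
   Context: For a finite group $G$, $O_{2}(G)$ denotes the $2$-core of $G$, that is, the largest normal $2$-subgroup of $G$. *)

theory Defs
  imports "HOL-Algebra.Algebra"
begin

(* card is 0 on infinite sets, so the cardinality condition also forces N to be finite when p > 0. *)
definition normal_p_subgroup :: "nat \<Rightarrow> 'a set \<Rightarrow> ('a, 'b) monoid_scheme \<Rightarrow> bool" where
  "normal_p_subgroup p N G \<longleftrightarrow> N \<lhd> G \<and> (\<exists>k. card N = p ^ k)"

(* The description operator is well defined for finite groups and prime p: see p_core_unique_exists. *)
definition p_core :: "nat \<Rightarrow> ('a, 'b) monoid_scheme \<Rightarrow> 'a set" where
  "p_core p G =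
     (THE N. normal_p_subgroup p N G \<and> (\<forall>K. normal_p_subgroup p K G \<longrightarrow> K \<subseteq> N))"

lemma (in group) normal_set_mult_normal:
  assumes "N \<lhd> G" "H \<lhd> G"
  shows "N <#> H \<lhd> G"
proof -
  have sg: "subgroup (N <#> H) G"
    using mult_norm_subgroup[OF assms(1) normal_imp_subgroup[OF assms(2)]] .
  have NC: "N \<subseteq> carrier G" and HC: "H \<subseteq> carrier G"
    using assms by (auto dest: normal_imp_subgroup subgroup.subset)
  have "x \<otimes> h \<otimes> inv x \<in> N <#> H" if x: "x \<in> carrier G" and h: "h \<in> N <#> H" for x h
  proof -
    from h obtain a b where ab: "a \<in> N" "b \<in> H" "h = a \<otimes> b"
      unfolding set_mult_def by auto
    have c: "a \<in> carrier G" "b \<in> carrier G" using ab NC HC by auto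
    have "x \<otimes> a \<otimes> inv x \<otimes> (x \<otimes> b \<otimes> inv x) = x \<otimes> a \<otimes> (inv x \<otimes> (x \<otimes> (b \<otimes> inv x)))"
      using c x by (simp add: m_assoc)
    also have "inv x \<otimes> (x \<otimes> (b \<otimes> inv x)) = b \<otimes> inv x"
      using c x by (simp flip: m_assoc)
    also have "x \<otimes> a \<otimes> (b \<otimes> inv x) = x \<otimes> h \<otimes> inv x"
      using c x ab by (simp add: m_assoc)
    finally have "x \<otimes> h \<otimes> inv x = (x \<otimes> a \<otimes> inv x) \<otimes> (x \<otimes> b \<otimes> inv x)" by simp
    moreover have "x \<otimes> a \<otimes> inv x \<in> N" "x \<otimes> b \<otimes> inv x \<in> H"
      using normal.inv_op_closed2[OF assms(1) x ab(1)] normal.inv_op_closed2[OF assms(2) x ab(2)] .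
    ultimately show ?thesis unfolding set_mult_def by blast
  qed
  then show ?thesis using sg by (simp add: normal_inv_iff)
qed

lemma (in group) normal_p_subgroup_set_mult:
  assumes p: "Factorial_Ring.prime (p :: nat)"
    and N: "normal_p_subgroup p N G" and H: "normal_p_subgroup p H G"
  shows "normal_p_subgroup p (N <#> H) G"
proof -
  have Nn: "N \<lhd> G" and Hn: "H \<lhd> G" using N H by (auto simp: normal_p_subgroup_def)
  have Hs: "subgroup H G" using normal_imp_subgroup[OF Hn] .
  obtain a b where a: "card N = p ^ a" and b: "card H = p ^ b"
    using N H by (auto simp: normal_p_subgroup_def)
  let ?P = "G\<lparr>carrier := N <#> H\<rparr>" and ?Q = "G\<lparr>carrier := H\<rparr>"
  have gP: "group ?P" using subgroup_imp_group[OF mult_norm_subgroup[OF Nn Hs]] .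
  have gQ: "group ?Q" using subgroup_imp_group[OF Hs] .
  have NP: "subgroup N ?P" using normal_imp_subgroup[OF normal_in_normal_set_mult[OF Nn Hs]] .
  have NQ: "subgroup (N \<inter> H) ?Q" using normal_imp_subgroup[OF normal_Int_subgroup[OF Hs Nn]] .
  have "card (carrier (?P Mod N)) = card (carrier (?Q Mod (N \<inter> H)))"
    using iso_same_card[OF weak_snd_iso_thme[OF Hs Nn]] .
  then have eq: "card (rcosets\<^bsub>?P\<^esub> N) = card (rcosets\<^bsub>?Q\<^esub> (N \<inter> H))"
    by (simp add: FactGroup_def)
  have "card (rcosets\<^bsub>?Q\<^esub> (N \<inter> H)) dvd p ^ b"
    using group.lagrange[OF gQ NQ] b by (simp add: order_def dvdI[OF sym])
  then obtain c where "card (rcosets\<^bsub>?Q\<^esub> (N \<inter> H)) = p ^ c"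
    using divides_primepow_nat[OF p] by blast
  then have "card (N <#> H) = p ^ c * p ^ a"
    using group.lagrange[OF gP NP] a eq by (simp add: order_def)
  then have "card (N <#> H) = p ^ (c + a)" by (simp add: power_add)
  then show ?thesis
    using normal_set_mult_normal[OF Nn Hn] by (auto simp: normal_p_subgroup_def)
qed

lemma (in group) p_core_unique_exists:
  assumes fin: "finite (carrier G)" and p: "Factorial_Ring.prime (p :: nat)"
  shows "\<exists>!N. normal_p_subgroup p N G \<and> (\<forall>K. normal_p_subgroup p K G \<longrightarrow> K \<subseteq> N)"
proof -
  have sub: "N \<subseteq> carrier G" if "normal_p_subgroup p N G" for N
    using that by (auto simp: normal_p_subgroup_def dest: normal_imp_subgroup subgroup.subset)
  have one: "normal_p_subgroup p {\<one>} G"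
    unfolding normal_p_subgroup_def using one_is_normal by (auto intro: exI[of _ 0])
  have "finite {N. normal_p_subgroup p N G}"
    by (rule finite_subset[of _ "Pow (carrier G)"]) (use sub fin in auto)
  then obtain N where N: "normal_p_subgroup p N G"
    and mx: "\<And>K. normal_p_subgroup p K G \<Longrightarrow> N \<subseteq> K \<Longrightarrow> N = K"
    using finite_has_maximal[of "{N. normal_p_subgroup p N G}"] one by blast
  have "K \<subseteq> N" if K: "normal_p_subgroup p K G" for K
  proof -
    have NK: "normal_p_subgroup p (N <#> K) G" using normal_p_subgroup_set_mult[OF p N K] .
    have o: "\<one> \<in> N" "\<one> \<in> K"
      using N K by (auto simp: normal_p_subgroup_def dest: normal_imp_subgroup subgroup.one_closed)
    have "N \<subseteq> N <#> K"
    proof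
      fix x assume "x \<in> N"
      then have "x = x \<otimes> \<one>" using sub[OF N] by auto
      then show "x \<in> N <#> K" using o \<open>x \<in> N\<close> unfolding set_mult_def by blast
    qed
    then have eq: "N = N <#> K" using mx NK by blast
    show "K \<subseteq> N"
    proof
      fix x assume "x \<in> K"
      then have "x = \<one> \<otimes> x" using sub[OF K] by auto
      then have "x \<in> N <#> K" using o \<open>x \<in> K\<close> unfolding set_mult_def by blast
      then show "x \<in> N" using eq by simp
    qed
  qed
  then show ?thesis using N by blast
qed

lemma (in group) p_core:
  assumes "finite (carrier G)" and "Factorial_Ring.prime (p :: nat)"
  shows normal_p_subgroup_p_core: "normal_p_subgroup p (p_core p G) G"
    and normal_p_subgroup_le_p_core: "\<And>K. normal_p_subgroup p K G \<Longrightarrow> K \<subseteq> p_core p G"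
  using theI'[OF p_core_unique_exists[OF assms]] unfolding p_core_def by blast+

end

theory Submission
  imports Defs
begin

text \<open>
  Let \<open>P\<close> be a Sylow 2-subgroup, of index 15, and suppose that \<open>O\<^sub>2(G) = 1\<close>.
  Since \<open>15 \<equiv> 3 (mod 4)\<close>, the action of \<open>P\<close> on its cosets has, besides the trivial one, an orbit of
  size 1 or 2. It gives a subgroup \<open>D\<close> of index at most 2 in \<open>P\<close> whose normalizer \<open>N\<close> is strictly larger
  than \<open>P\<close>, so that \<open>m = |G : N|\<close> is 1, 3 or 5. Let \<open>K\<close> be the core of \<open>N\<close>. Then \<open>D \<inter> K\<close> is a normal
  2-subgroup of \<open>K\<close>, hence trivial, and \<open>D\<close>, of order at least 8, embeds into \<open>G / K \<le> S\<^sub>m\<close>.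
  This forces \<open>m = 5\<close>, \<open>r = 4\<close> and \<open>|D| = 8\<close>, so \<open>G / K\<close> has order 40 or 120. If it is 120 then \<open>K\<close> is a
  normal subgroup of order 2. If it is 40 then the Sylow 5-subgroup of \<open>G / K\<close> is normal, and as its
  automorphism group has only 4 elements, a nontrivial element of the image of \<open>D\<close> centralizes it;
  all conjugates of that element then stay in \<open>N / K\<close>, contradicting the choice of \<open>K\<close> as the core.
\<close>

section \<open>Preliminaries on orders, conjugation and normalizers\<close>

lemma card_carrier_BijGroup:
  assumes "finite E"
  shows "card (carrier (BijGroup E)) = fact (card E)"
proof -
  \<comment> \<open>Off \<open>E\<close>, members of \<open>Bij E\<close> are
    \<open>undefined\<close> while a map that \<open>permutes E\<close> is the identity. Changing
    this default value in both directions transfers the known count of permutations.\<close>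
  have "bij_betw (\<lambda>p. restrict p E) {p. p permutes E} (Bij E)"
  proof (rule bij_betw_byWitness[where f' = "\<lambda>f x. if x \<in> E then f x else x"])
    show "\<forall>p\<in>{p. p permutes E}. (\<lambda>x. if x \<in> E then restrict p E x else x) = p"
      by (auto simp: fun_eq_iff permutes_not_in)
    show "\<forall>f\<in>Bij E. restrict (\<lambda>x. if x \<in> E then f x else x) E = f"
      by (auto simp: Bij_def extensional_def fun_eq_iff)
    show "(\<lambda>p. restrict p E) ` {p. p permutes E} \<subseteq> Bij E"
      by (auto simp: Bij_def permutes_imp_bij)
    show "(\<lambda>f x. if x \<in> E then f x else x) ` Bij E \<subseteq> {p. p permutes E}"
      by (auto simp: Bij_def intro!: bij_imp_permutes cong: bij_betw_cong)
  qed
  then show ?thesis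
    using card_permutations[OF refl assms] bij_betw_same_card
    by (fastforce simp: BijGroup_def)
qed

lemma (in group) card_subgroup_dvd_order: "subgroup H G \<Longrightarrow> card H dvd order G"
  using lagrange[of H] by (metis dvd_triv_right)

lemma (in group) card_subgroup_dvd_card:
  assumes "subgroup H G" "subgroup K G" "H \<subseteq> K"
  shows "card H dvd card K"
  using group.card_subgroup_dvd_order[OF subgroup_imp_group[OF assms(2)] subgroup_incl[OF assms]]
  by (simp add: order_def)

text \<open>Both sides say that \<open>x \<otimes> y\<close> lies in the coset
  \<open>H #> x\<close>.\<close>

lemma (in group) conjugate_in_iff:
  assumes "subgroup H G" "x \<in> carrier G" "y \<in> carrier G"
  shows "x \<otimes> y \<otimes> inv x \<in> H \<longleftrightarrow> H #> x \<otimes> y = H #> x"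
proof -
  have "H #> x \<otimes> y = H #> x \<longleftrightarrow> x \<otimes> y \<in> H #> x"
    using assms by (metis m_closed rcos_self repr_independence)
  then show ?thesis
    using subgroup.rcos_module[OF assms(1) group_axioms, of x "x \<otimes> y"] assms by simp
qed

lemma (in group) conjugate_mult:
  assumes "a \<in> carrier G" "b \<in> carrier G" "y \<in> carrier G"
  shows "(a \<otimes> b) \<otimes> y \<otimes> inv (a \<otimes> b) = a \<otimes> (b \<otimes> y \<otimes> inv b) \<otimes> inv a"
  using assms by (simp add: inv_mult_group m_assoc)

lemma (in group) conjugation_iso:
  assumes "K \<lhd> G" "g \<in> carrier G"
  shows "(\<lambda>x. g \<otimes> x \<otimes> inv g) \<in> iso (G\<lparr>carrier := K\<rparr>) (G\<lparr>carrier := K\<rparr>)"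
proof -
  have K: "K \<subseteq> carrier G" using assms(1) by (simp add: normal_imp_subgroup subgroup.subset)
  have c: "h \<otimes> x \<otimes> inv h \<in> K" if "h \<in> carrier G" "x \<in> K" for h x
    using normal.inv_op_closed2[OF assms(1)] that by blast
  have "bij_betw (\<lambda>x. g \<otimes> x \<otimes> inv g) K K"
  proof (rule bij_betw_byWitness[where f' = "\<lambda>x. inv g \<otimes> x \<otimes> inv (inv g)"])
    show "\<forall>a\<in>K. inv g \<otimes> (g \<otimes> a \<otimes> inv g) \<otimes> inv (inv g) = a"
      using K assms(2) conjugate_mult[of "inv g" g] by (auto simp: subset_iff)
    show "\<forall>a\<in>K. g \<otimes> (inv g \<otimes> a \<otimes> inv (inv g)) \<otimes> inv g = a"
      using K assms(2) conjugate_mult[of g "inv g"] by (auto simp: subset_iff)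
  qed (use c c[of "inv g"] assms(2) in auto)
  moreover have "g \<otimes> (a \<otimes> b) \<otimes> inv g = (g \<otimes> a \<otimes> inv g) \<otimes> (g \<otimes> b \<otimes> inv g)"
    if "a \<in> K" "b \<in> K" for a b
  proof -
    have ab: "a \<in> carrier G" "b \<in> carrier G" using K that by auto
    have "inv g \<otimes> (g \<otimes> (b \<otimes> inv g)) = b \<otimes> inv g"
      using ab assms(2) by (simp flip: m_assoc)
    then show ?thesis using ab assms(2) by (simp add: m_assoc)
  qed
  ultimately show ?thesis
    using c assms(2) by (auto simp: iso_def hom_def)
qed

text \<open>The library normalizer asks that conjugation map \<open>H\<close> onto itself.
  Conjugation is injective, so for finite \<open>H\<close> mapping into \<open>H\<close> is
  enough.\<close>

lemma (in group) normalizer_iff: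
  assumes fin: "finite (carrier G)" and H: "subgroup H G"
  shows "x \<in> normalizer G H \<longleftrightarrow> x \<in> carrier G \<and> (\<forall>h\<in>H. x \<otimes> h \<otimes> inv x \<in> H)"
proof -
  have HC: "H \<subseteq> carrier G" using H by (rule subgroup.subset)
  have img: "x <# H #> inv x = (\<lambda>h. x \<otimes> h \<otimes> inv x) ` H"
    by (auto simp: l_coset_def r_coset_def)
  have "(\<lambda>h. x \<otimes> h \<otimes> inv x) ` H = H" if x: "x \<in> carrier G" and c: "\<forall>h\<in>H. x \<otimes> h \<otimes> inv x \<in> H"
  proof (rule card_subset_eq)
    show "finite H" using fin HC finite_subset by blast
    have "inj_on (\<lambda>h. x \<otimes> h \<otimes> inv x) H"
      using x HC by (intro inj_onI) (auto simp: subset_iff)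
    then show "card ((\<lambda>h. x \<otimes> h \<otimes> inv x) ` H) = card H" by (rule card_image)
  qed (use c in auto)
  then show ?thesis
    using HC by (auto simp: normalizer_def stabilizer_def img)
qed

text \<open>For \<open>p\<close> outside \<open>D\<close>, the disjoint sets \<open>D\<close> and
  \<open>pD\<close> already fill \<open>P\<close>. If the conjugate of \<open>d\<close> were in
  \<open>pD\<close>, cancelling \<open>p\<close> would put \<open>d \<otimes> inv p\<close> and
  hence \<open>p\<close> into \<open>D\<close>. The inequality on cardinalities covers index 1 and
  index 2 together.\<close>

lemma (in group) index_2_conjugate:
  assumes D: "subgroup D G" and P: "subgroup P G" and sub: "D \<subseteq> P"
    and fin: "finite P" and card: "card P \<le> 2 * card D"
    and p: "p \<in> P" and d: "d \<in> D"
  shows "p \<otimes> d \<otimes> inv p \<in> D"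
proof (cases "p \<in> D")
  case True
  then show ?thesis using D d by (simp add: subgroup.m_closed subgroup.m_inv_closed)
next
  case False
  have C: "p \<in> carrier G" "P \<subseteq> carrier G" "D \<subseteq> carrier G"
    using p P sub by (auto dest: subgroup.subset)
  have disj: "p \<otimes> e \<notin> D" if "e \<in> D" for e
  proof
    assume "p \<otimes> e \<in> D"
    then have "p \<otimes> e \<otimes> inv e \<in> D" using D that by (simp add: subgroup.m_closed subgroup.m_inv_closed)
    moreover have "p \<otimes> e \<otimes> inv e = p" using C that by (simp add: m_assoc subset_iff)
    ultimately show False using False by simp
  qed
  have "inj_on ((\<otimes>) p) D" using C by (intro inj_onI) (auto simp: subset_iff)
  then have "card (D \<union> (\<otimes>) p ` D) = 2 * card D"
    using disj finite_subset[OF sub fin] by (subst card_Un_disjoint) (auto simp: card_image)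
  moreover have "D \<union> (\<otimes>) p ` D \<subseteq> P" using sub p P by (auto simp: subgroup.m_closed)
  ultimately have eq: "D \<union> (\<otimes>) p ` D = P"
    using fin card by (intro card_seteq) auto
  show ?thesis
  proof (rule ccontr)
    assume n: "p \<otimes> d \<otimes> inv p \<notin> D"
    have "p \<otimes> d \<otimes> inv p \<in> P"
      using p d sub P by (auto intro: subgroup.m_closed subgroup.m_inv_closed)
    then obtain e where e: "e \<in> D" "p \<otimes> d \<otimes> inv p = p \<otimes> e" using eq n by auto
    then have "p \<otimes> (d \<otimes> inv p) = p \<otimes> e" using C d by (auto simp: m_assoc subset_iff)
    then have "d \<otimes> inv p = e" using C d e(1) by (auto simp: subset_iff)
    then have "inv p = inv d \<otimes> e" using C d e(1) by (metis inv_closed inv_solve_left subsetD)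
    then have "inv p \<in> D" using D d e(1) by (simp add: subgroup.m_closed subgroup.m_inv_closed)
    then have "p \<in> D" using D C(1) subgroup.m_inv_closed[OF D, of "inv p"] by simp
    then show False using False by simp
  qed
qed

section \<open>The action on right cosets, its kernel, and orbit counting\<close>

text \<open>The inverse turns right multiplication into a left action, hence a homomorphism. The
  restriction to the cosets makes each map extensional, as membership in \<open>Bij\<close>
  demands.\<close>

definition coset_action :: "('a, 'b) monoid_scheme \<Rightarrow> 'a set \<Rightarrow> 'a \<Rightarrow> 'a set \<Rightarrow> 'a set" where
  "coset_action G H g = (\<lambda>R \<in> rcosets\<^bsub>G\<^esub> H. R #>\<^bsub>G\<^esub> inv\<^bsub>G\<^esub> g)"

lemma (in group) coset_action_apply:
  assumes "subgroup H G" "g \<in> carrier G" "x \<in> carrier G"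
  shows "coset_action G H g (H #> x) = H #> x \<otimes> inv g"
  using assms by (simp add: coset_action_def rcosetsI coset_mult_assoc subgroup.subset)

lemma (in group) rcosetsE:
  assumes "R \<in> rcosets H" obtains x where "x \<in> carrier G" "R = H #> x"
  using assms by (auto simp: RCOSETS_def)

lemma (in group) coset_action_group_action:
  assumes H: "subgroup H G"
  shows "group_action G (rcosets H) (coset_action G H)"
proof -
  let ?E = "rcosets H"
  have HC: "H \<subseteq> carrier G" using H by (rule subgroup.subset)
  have cl: "coset_action G H g R \<in> ?E" if "g \<in> carrier G" "R \<in> ?E" for g R
    using that(2) by (rule rcosetsE) (simp add: coset_action_apply[OF H] that HC rcosetsI)
  have comp: "coset_action G H (g \<otimes> h) R = coset_action G H g (coset_action G H h R)"
    if "g \<in> carrier G" "h \<in> carrier G" "R \<in> ?E" for g h R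
    using that(3) by (rule rcosetsE) (simp add: coset_action_apply[OF H] that inv_mult_group m_assoc)
  have one: "coset_action G H \<one> R = R" if "R \<in> ?E" for R
    using that by (rule rcosetsE) (simp add: coset_action_apply[OF H])
  have bij: "coset_action G H g \<in> Bij ?E" if g: "g \<in> carrier G" for g
  proof -
    have "bij_betw (coset_action G H g) ?E ?E"
      by (rule bij_betw_byWitness[where f' = "coset_action G H (inv g)"])
        (use g cl one comp[of g "inv g"] comp[of "inv g" g] in auto)
    then show ?thesis by (simp add: Bij_def coset_action_def)
  qed
  have "coset_action G H (g \<otimes> h) = compose ?E (coset_action G H g) (coset_action G H h)"
    if "g \<in> carrier G" "h \<in> carrier G" for g h
  proof (rule extensionalityI[where A = ?E])
    show "coset_action G H (g \<otimes> h) \<in> extensional ?E" by (simp add: coset_action_def)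
  qed (use comp that in \<open>auto simp: compose_def\<close>)
  then have "coset_action G H \<in> hom G (BijGroup ?E)"
    using bij by (auto simp: hom_def BijGroup_def)
  then show ?thesis
    by (simp add: group_action_def group_hom_def group_hom_axioms_def group_BijGroup group_axioms)
qed

text \<open>The stabilizer of \<open>H #> x\<close> is the conjugate of \<open>H\<close> by
  \<open>inv x\<close>. The inverse in \<open>coset_action\<close> disappears because
  \<open>H\<close> is closed under inverses.\<close>

lemma (in group) coset_action_fixes:
  assumes H: "subgroup H G" and "g \<in> carrier G" "x \<in> carrier G"
  shows "coset_action G H g (H #> x) = H #> x \<longleftrightarrow> x \<otimes> g \<otimes> inv x \<in> H"
proof -
  have "x \<otimes> inv g \<otimes> inv x = inv (x \<otimes> g \<otimes> inv x)"
    using assms by (simp add: inv_mult_group m_assoc)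
  then have "x \<otimes> inv g \<otimes> inv x \<in> H \<longleftrightarrow> x \<otimes> g \<otimes> inv x \<in> H"
    using assms by (metis inv_closed inv_inv m_closed subgroup.m_inv_closed)
  then show ?thesis
    using assms conjugate_in_iff[OF H, of x "inv g"] by (simp add: coset_action_apply)
qed

text \<open>The right-hand side is the normal core of \<open>H\<close>, the intersection of all its
  conjugates.\<close>

lemma (in group) kernel_coset_action:
  assumes H: "subgroup H G"
  shows "kernel G (BijGroup (rcosets H)) (coset_action G H) =
    {g \<in> carrier G. \<forall>x\<in>carrier G. x \<otimes> g \<otimes> inv x \<in> H}" (is "?L = ?R")
proof -
  have "coset_action G H g = (\<lambda>R\<in>rcosets H. R) \<longleftrightarrow> (\<forall>x\<in>carrier G. x \<otimes> g \<otimes> inv x \<in> H)"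
    if g: "g \<in> carrier G" for g
  proof -
    have "coset_action G H g = (\<lambda>R\<in>rcosets H. R) \<longleftrightarrow> (\<forall>R\<in>rcosets H. coset_action G H g R = R)"
      by (auto simp: fun_eq_iff coset_action_def)
    also have "\<dots> \<longleftrightarrow> (\<forall>x\<in>carrier G. x \<otimes> g \<otimes> inv x \<in> H)"
      using coset_action_fixes[OF H g] by (auto simp: RCOSETS_def)
    finally show ?thesis .
  qed
  then show ?thesis by (auto simp: kernel_def BijGroup_def)
qed

text \<open>Orbits partition \<open>E\<close>; the fixed points are exactly the singleton orbits of
  \<open>?S\<close>, and all other orbits vanish modulo \<open>d\<close>. An arbitrary
  \<open>d\<close> allows the use both with a prime and with 4.\<close>

lemma (in group_action) card_cong_card_fixed:
  assumes fin: "finite E"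
    and orb: "\<And>x. x \<in> E \<Longrightarrow> \<not> (\<forall>g\<in>carrier G. \<phi> g x = x) \<Longrightarrow> d dvd card (orbit G \<phi> x)"
  shows "card E mod d = card {x \<in> E. \<forall>g\<in>carrier G. \<phi> g x = x} mod d"
proof -
  let ?F = "{x \<in> E. \<forall>g\<in>carrier G. \<phi> g x = x}"
  let ?O = "orbits G E \<phi>"
  let ?S = "(\<lambda>x. {x}) ` ?F"
  interpret group G using group_hom group_hom.axioms(1) by auto
  have sing: "orbit G \<phi> x = {x}" if "x \<in> E" "\<forall>g\<in>carrier G. \<phi> g x = x" for x
    using that orbit_refl[of x] by (auto simp: orbit_def)
  have OE: "finite ?O" using fin by (auto simp: orbits_def)
  have sub: "?S \<subseteq> ?O" using sing by (force simp: orbits_def)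
  have "card E = (\<Sum>b\<in>?O. card b)"
    using disjoint_sum[OF fin, of "\<lambda>_. 1::nat"] by simp
  also have "\<dots> = (\<Sum>b\<in>?O - ?S. card b) + (\<Sum>b\<in>?S. card b)"
    using OE sub by (rule sum.subset_diff[rotated])
  also have "(\<Sum>b\<in>?S. card b) = card ?F"
    by (subst sum.reindex) auto
  finally have eq: "card E = (\<Sum>b\<in>?O - ?S. card b) + card ?F" .
  have "d dvd (\<Sum>b\<in>?O - ?S. card b)"
  proof (rule dvd_sum)
    fix b assume b: "b \<in> ?O - ?S"
    then obtain x where x: "x \<in> E" "b = orbit G \<phi> x" by (auto simp: orbits_def)
    then have "\<not> (\<forall>g\<in>carrier G. \<phi> g x = x)" using b sing by auto
    then show "d dvd card b" using orb x by simp
  qed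
  then show ?thesis unfolding eq by (auto elim: dvdE)
qed


section \<open>Image and kernel orders, and cores of normal subgroups\<close>

lemma (in group_hom) card_image_mult_card_kernel:
  "card (h ` carrier G) * card (kernel G H h) = order G"
proof -
  \<comment> \<open>Cutting the codomain down to the image makes \<open>h\<close> surjective, as the
    first isomorphism theorem requires, and leaves the kernel unchanged.\<close>
  let ?I = "H\<lparr>carrier := h ` carrier G\<rparr>"
  have "subgroup (h ` carrier G) H" by (rule img_is_subgroup)
  then have "group_hom G ?I h"
    using homh H.subgroup_imp_group
    by (auto simp: group_hom_def group_hom_axioms_def hom_def G.group_axioms)
  then have "(\<lambda>Y. the_elem (h ` Y)) \<in> iso (G Mod kernel G ?I h) ?I"
    by (rule group_hom.FactGroup_iso_set) simp
  then have "card (rcosets (kernel G H h)) = card (h ` carrier G)"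
    using iso_same_card[OF is_isoI] by (fastforce simp: FactGroup_def kernel_def)
  then show ?thesis using G.lagrange[OF subgroup_kernel] by simp
qed

text \<open>Conjugation by an element of \<open>G\<close> is an automorphism of \<open>K\<close>, so
  it sends the \<open>p\<close>-core of \<open>K\<close> to a normal \<open>p\<close>-subgroup of
  \<open>K\<close>, which lies in that core by maximality. Thus the core of \<open>K\<close>, which
  contains \<open>L\<close>, is normal in \<open>G\<close>.\<close>

lemma (in group) p_core_nontrivialI:
  assumes fin: "finite (carrier G)" and p: "Factorial_Ring.prime (p :: nat)"
    and K: "K \<lhd> G" and L: "normal_p_subgroup p L (G\<lparr>carrier := K\<rparr>)" and ne: "L \<noteq> {\<one>}"
  shows "p_core p G \<noteq> {\<one>}"
proof -
  let ?K = "G\<lparr>carrier := K\<rparr>"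
  let ?M = "p_core p ?K"
  have Ks: "subgroup K G" using K by (rule normal_imp_subgroup)
  interpret K: group ?K using Ks by (rule subgroup_imp_group)
  have finK: "finite (carrier ?K)"
    using Ks fin by (auto dest: subgroup.subset intro: finite_subset)
  note core = K.p_core[OF finK p]
  have M: "?M \<lhd> ?K" "\<exists>k. card ?M = p ^ k" using core(1) by (auto simp: normal_p_subgroup_def)
  have Ms: "subgroup ?M G" using incl_subgroup[OF Ks] M(1) by (simp add: normal_imp_subgroup)
  have "?M \<lhd> G"
  proof (rule normal_invI[OF Ms])
    fix x h assume x: "x \<in> carrier G" and h: "h \<in> ?M"
    let ?c = "\<lambda>h. x \<otimes> h \<otimes> inv x"
    have "?c \<in> iso ?K ?K" by (rule conjugation_iso[OF K x])
    then have "?c ` ?M \<lhd> ?K"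
      using iso_normal_subgroup K.group_axioms M(1) by blast
    moreover have "card (?c ` ?M) = card ?M"
      using x subgroup.mem_carrier[OF Ms] by (intro card_image inj_onI) auto
    ultimately have "normal_p_subgroup p (?c ` ?M) ?K"
      using M(2) by (simp add: normal_p_subgroup_def)
    then have "?c ` ?M \<subseteq> ?M" by (rule core(2))
    then show "?c h \<in> ?M" using h by blast
  qed
  then have "?M \<subseteq> p_core p G"
    using M(2) p_core(2)[OF fin p] by (simp add: normal_p_subgroup_def)
  moreover have "L \<subseteq> ?M" by (rule core(2)[OF L])
  moreover have "\<one> \<in> L"
    using L subgroup.one_closed[of L ?K] by (auto simp: normal_p_subgroup_def dest: normal_imp_subgroup)
  ultimately show ?thesis using ne by blast
qed

section \<open>Fixed points of a p-subgroup on its own cosets\<close>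

lemma (in group) coset_action_subgroup:
  assumes H: "subgroup H G" and P: "subgroup P G"
  shows "group_action (G\<lparr>carrier := P\<rparr>) (rcosets H) (coset_action G H)"
  by (rule group_action.induced_action[OF coset_action_group_action[OF H] P])

text \<open>\<open>H\<close> acts on its own cosets. Orbit lengths are powers of \<open>p\<close>,
  so only fixed cosets count modulo \<open>p\<close>, and \<open>H #> x\<close> is fixed exactly
  when \<open>x\<close> normalizes \<open>H\<close>.\<close>

lemma (in group) card_rcosets_mod_prime:
  assumes fin: "finite (carrier G)" and H: "subgroup H G"
    and p: "Factorial_Ring.prime (p :: nat)" and card: "card H = p ^ k"
  shows "card (rcosets H) mod p = card (normalizer G H) div card H mod p"
proof -
  let ?H = "G\<lparr>carrier := H\<rparr>" and ?N = "normalizer G H"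
  interpret A: group_action ?H "rcosets H" "coset_action G H"
    by (rule coset_action_subgroup[OF H H])
  have HC: "H \<subseteq> carrier G" using H by (rule subgroup.subset)
  have Ns: "subgroup ?N G" using HC by (rule normalizer_imp_subgroup)
  interpret N: group "G\<lparr>carrier := ?N\<rparr>" using Ns by (rule subgroup_imp_group)
  have finE: "finite (rcosets H)" using fin H by (simp add: rcosets_finite RCOSETS_def)
  have "p dvd card (orbit ?H (coset_action G H) R)"
    if R: "R \<in> rcosets H" and nf: "\<not> (\<forall>g\<in>carrier ?H. coset_action G H g R = R)" for R
  proof -
    let ?O = "orbit ?H (coset_action G H) R"
    have "card ?O dvd p ^ k"
      using A.orbit_stabilizer_theorem[OF R] card by (auto simp: order_def intro: dvdI[OF sym])
    then obtain i where i: "card ?O = p ^ i" using divides_primepow_nat[OF p] by blast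
    \<comment> \<open>The exponent 0 would make \<open>R\<close> a fixed point.\<close>
    have "card ?O \<noteq> 1"
    proof
      assume "card ?O = 1"
      then obtain S where "?O = {S}" by (auto simp: card_1_singleton_iff)
      moreover have "R \<in> ?O" using A.orbit_refl[OF R] .
      ultimately show False using nf by (auto simp: orbit_def)
    qed
    then show ?thesis using i by (cases i) auto
  qed
  then have "card (rcosets H) mod p =
      card {R \<in> rcosets H. \<forall>g\<in>carrier ?H. coset_action G H g R = R} mod p"
    using A.card_cong_card_fixed[OF finE] by blast
  also have "{R \<in> rcosets H. \<forall>g\<in>carrier ?H. coset_action G H g R = R} =
      rcosets\<^bsub>G\<lparr>carrier := ?N\<rparr>\<^esub> H"
    using coset_action_fixes[OF H] normalizer_iff[OF fin H] HC
    by (auto simp: RCOSETS_def subset_iff)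
  also have "card (rcosets\<^bsub>G\<lparr>carrier := ?N\<rparr>\<^esub> H) = card ?N div card H"
  proof -
    have "subgroup H (G\<lparr>carrier := ?N\<rparr>)"
      using subgroup_in_normalizer[OF H] by (rule normal_imp_subgroup)
    then have "card (rcosets\<^bsub>G\<lparr>carrier := ?N\<rparr>\<^esub> H) * card H = card ?N"
      using N.lagrange by (simp add: order_def)
    moreover have "card H > 0"
      using fin HC subgroup.one_closed[OF H] by (metis card_gt_0_iff empty_iff finite_subset)
    ultimately show ?thesis by (metis nonzero_mult_div_cancel_right less_numeral_extra(3))
  qed
  finally show ?thesis .
qed

section \<open>Groups of order 40\<close>

text \<open>The index of \<open>F\<close> in its normalizer divides 8 and is congruent to 8, that is
  to 3, modulo 5. Among 1, 2, 4 and 8 only 8 qualifies.\<close>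

lemma (in group) normal_Sylow_5_order_40:
  assumes ord: "order G = 40" and F: "subgroup F G" and cF: "card F = 5"
  shows "F \<lhd> G"
proof -
  let ?N = "normalizer G F"
  have fin: "finite (carrier G)" using ord by (simp flip: order_gt_0_iff_finite)
  have FC: "F \<subseteq> carrier G" using F by (rule subgroup.subset)
  have Ns: "subgroup ?N G" using FC by (rule normalizer_imp_subgroup)
  have "card (rcosets F) = 8" using lagrange[OF F] ord cF by simp
  then have mod: "card ?N div 5 mod 5 = 3"
    using card_rcosets_mod_prime[OF fin F, of 5 1] cF by simp
  have "5 dvd card ?N"
    using group.card_subgroup_dvd_order[OF subgroup_imp_group[OF Ns]
        normal_imp_subgroup[OF subgroup_in_normalizer[OF F]]] cF
    by (simp add: order_def)
  then obtain k where k: "card ?N = 5 * k" by blast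
  have "card ?N dvd 40" using card_subgroup_dvd_order[OF Ns] ord by simp
  then have "k dvd 8" using k by auto
  then have "k \<in> {1, 2, 4, 8}"
  proof -
    have "k \<le> 8" using \<open>k dvd 8\<close> by (simp add: dvd_imp_le)
    then have "k \<in> {0,1,2,3,4,5,6,7,8}" by auto
    then show ?thesis using \<open>k dvd 8\<close> by auto
  qed
  then have "k = 8" using mod k by auto
  then have "card ?N = card (carrier G)" using k ord by (simp add: order_def)
  then have "?N = carrier G" using fin Ns by (simp add: card_subset_eq subgroup.subset)
  then show ?thesis using normalizer_iff[OF fin F] F by (intro normal_invI) auto
qed


text \<open>This says that a subgroup of order 8 has nontrivial core. The witness \<open>e\<close>
  centralizes the normal subgroup \<open>F\<close> of order 5, and the whole group is the product of
  \<open>B\<close> and \<open>F\<close>.\<close>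

lemma (in group) order_40_core:
  assumes ord: "order G = 40" and B: "subgroup B G" and cB: "card B = 8"
  shows "\<exists>e\<in>B. e \<noteq> \<one> \<and> (\<forall>g\<in>carrier G. g \<otimes> e \<otimes> inv g \<in> B)"
proof -
  have fin: "finite (carrier G)" using ord by (simp flip: order_gt_0_iff_finite)
  have "Factorial_Ring.prime (5::nat)" by simp
  then obtain F where F: "subgroup F G" and cF: "card F = 5"
    using sylow_thm[of 5 G 1 8] ord fin group_axioms by auto
  have Fn: "F \<lhd> G" by (rule normal_Sylow_5_order_40[OF ord F cF])
  have FC: "F \<subseteq> carrier G" and BC: "B \<subseteq> carrier G" using F B by (auto dest: subgroup.subset)
  have finF: "finite F" using FC fin finite_subset by auto
  have "F \<noteq> {\<one>}" using cF by auto
  then obtain f where f: "f \<in> F" "f \<noteq> \<one>" using subgroup.one_closed[OF F] by blast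
  have fC: "f \<in> carrier G" using f FC by blast
  let ?c = "\<lambda>b. b \<otimes> f \<otimes> inv b"
  \<comment> \<open>Eight conjugating elements have only four possible values, so two of them agree
    on \<open>f\<close>; their quotient \<open>e\<close> commutes with \<open>f\<close>.\<close>
  have "?c ` B \<subseteq> F - {\<one>}"
  proof
    fix y assume "y \<in> ?c ` B"
    then obtain b where b: "b \<in> B" "y = ?c b" by blast
    have bC: "b \<in> carrier G" using b BC by blast
    have "y \<noteq> \<one>"
    proof
      assume "y = \<one>"
      then have "b \<otimes> f = b \<otimes> \<one>" using b(2) bC fC by (metis inv_solve_right' l_one m_closed one_closed r_one)
      then show False using bC fC f(2) by simp
    qed
    then show "y \<in> F - {\<one>}" using normal.inv_op_closed2[OF Fn bC f(1)] b(2) by simp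
  qed
  then have "card (?c ` B) \<le> card (F - {\<one>})" using finF by (intro card_mono) auto
  also have "\<dots> = 4" using cF subgroup.one_closed[OF F] by simp
  finally have "\<not> inj_on ?c B" using cB card_image by fastforce
  then obtain a b where ab: "a \<in> B" "b \<in> B" "a \<noteq> b" "?c a = ?c b" by (auto simp: inj_on_def)
  define e where "e = inv b \<otimes> a"
  have aC: "a \<in> carrier G" and bC: "b \<in> carrier G" using ab BC by auto
  have eB: "e \<in> B" using ab B by (simp add: e_def subgroup.m_closed subgroup.m_inv_closed)
  have eC: "e \<in> carrier G" using eB BC by blast
  have ne: "e \<noteq> \<one>" using ab(3) aC bC by (metis e_def inv_closed inv_equality inv_inv)
  have "e \<otimes> f \<otimes> inv e = inv b \<otimes> ?c a \<otimes> inv (inv b)"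
    unfolding e_def using conjugate_mult[of "inv b" a f] aC bC fC by simp
  also have "\<dots> = f"
    unfolding ab(4) using conjugate_mult[of "inv b" b f] bC fC by simp
  finally have ef: "e \<otimes> f \<otimes> inv e = f" .
  then have ef: "e \<otimes> f = f \<otimes> e" using eC fC by (metis inv_solve_right m_closed)
  \<comment> \<open>The centralizer of \<open>e\<close> in \<open>F\<close> has order dividing 5 and
    contains \<open>f\<close>, so it is all of \<open>F\<close>.\<close>
  let ?C = "{y \<in> F. e \<otimes> y = y \<otimes> e}"
  have Cs: "subgroup ?C G"
  proof (rule subgroupI)
    show "?C \<noteq> {}" using f ef by blast
    fix y assume y: "y \<in> ?C"
    have yC: "y \<in> carrier G" using y FC by blast
    have "inv y \<otimes> (e \<otimes> y) \<otimes> inv y = inv y \<otimes> e" using yC eC by (simp add: m_assoc)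
    moreover have "inv y \<otimes> (y \<otimes> e) \<otimes> inv y = e \<otimes> inv y" using yC eC by (simp flip: m_assoc)
    ultimately show "inv y \<in> ?C" using y F by (simp add: subgroup.m_inv_closed)
    fix z assume z: "z \<in> ?C"
    have zC: "z \<in> carrier G" using z FC by blast
    have "e \<otimes> (y \<otimes> z) = y \<otimes> (e \<otimes> z)" using y yC zC eC by (simp flip: m_assoc)
    also have "\<dots> = (y \<otimes> z) \<otimes> e" using z yC zC eC by (simp add: m_assoc)
    finally show "y \<otimes> z \<in> ?C" using y z F by (simp add: subgroup.m_closed)
  qed (use FC in auto)
  have "card ?C dvd 5" using card_subgroup_dvd_card[OF Cs F] cF by auto
  moreover have "card ?C \<noteq> 1"
  proof
    assume "card ?C = 1"
    then obtain z where "?C = {z}" by (auto simp: card_1_singleton_iff)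
    moreover have "\<one> \<in> ?C" using Cs by (rule subgroup.one_closed)
    moreover have "f \<in> ?C" using f ef by blast
    ultimately show False using f(2) by (metis singletonD)
  qed
  moreover have "Factorial_Ring.prime (5::nat)" by simp
  ultimately have "card ?C = 5" using prime_nat_iff by blast
  then have "?C = F" using finF cF by (intro card_subset_eq) auto
  then have cent: "e \<otimes> y = y \<otimes> e" if "y \<in> F" for y using that by blast
  have "B \<inter> F = {\<one>}"
  proof -
    have s: "subgroup (B \<inter> F) G" using B F by (rule subgroups_Inter_pair)
    have "card (B \<inter> F) dvd 8" "card (B \<inter> F) dvd 5"
      using card_subgroup_dvd_card[OF s B] card_subgroup_dvd_card[OF s F] cB cF by auto
    moreover have "coprime 8 (5::nat)" by (simp add: coprime_iff_gcd_eq_1 gcd_non_0_nat)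
    ultimately have "card (B \<inter> F) = 1" using coprime_common_divisor_nat by blast
    then show ?thesis using subgroup.one_closed[OF s] by (metis card_1_singletonE singletonD)
  qed
  \<comment> \<open>Two factorizations of one element differ by an element of the trivial
    intersection of \<open>B\<close> and \<open>F\<close>. The 8 * 5 products are therefore distinct
    and exhaust the group.\<close>
  have "inj_on (\<lambda>(b, y). b \<otimes> y) (B \<times> F)"
  proof (rule inj_onI, clarify)
    fix b y c z assume h: "b \<in> B" "y \<in> F" "c \<in> B" "z \<in> F" "b \<otimes> y = c \<otimes> z"
    have C: "b \<in> carrier G" "y \<in> carrier G" "c \<in> carrier G" "z \<in> carrier G" using h BC FC by auto
    have "inv c \<otimes> (b \<otimes> y) \<otimes> inv y = inv c \<otimes> b" using C by (simp add: m_assoc)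
    moreover have "inv c \<otimes> (c \<otimes> z) \<otimes> inv y = z \<otimes> inv y" using C by (simp flip: m_assoc)
    ultimately have "inv c \<otimes> b = z \<otimes> inv y" using h(5) by simp
    moreover have "inv c \<otimes> b \<in> B" "z \<otimes> inv y \<in> F"
      using h B F by (simp_all add: subgroup.m_closed subgroup.m_inv_closed)
    ultimately have "inv c \<otimes> b = \<one>" "z \<otimes> inv y = \<one>" using \<open>B \<inter> F = {\<one>}\<close> by auto
    then show "b = c \<and> y = z" using C inv_solve_left[of \<one> c b] inv_solve_right[of \<one> z y] by simp
  qed
  then have "card ((\<lambda>(b, y). b \<otimes> y) ` (B \<times> F)) = card (carrier G)"
    using cB cF ord by (simp add: card_image card_cartesian_product order_def)
  moreover have "(\<lambda>(b, y). b \<otimes> y) ` (B \<times> F) \<subseteq> carrier G" using BC FC by auto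
  ultimately have all: "(\<lambda>(b, y). b \<otimes> y) ` (B \<times> F) = carrier G"
    using fin by (intro card_subset_eq) auto
  \<comment> \<open>The factor of \<open>g\<close> from \<open>F\<close> fixes \<open>e\<close>
    under conjugation, and the factor from \<open>B\<close> keeps it in \<open>B\<close>.\<close>
  have "g \<otimes> e \<otimes> inv g \<in> B" if "g \<in> carrier G" for g
  proof -
    have "g \<in> (\<lambda>(b, y). b \<otimes> y) ` (B \<times> F)" using that by (simp only: all)
    then obtain c y where cy: "c \<in> B" "y \<in> F" "g = c \<otimes> y" by (elim imageE SigmaE) simp
    have C: "c \<in> carrier G" "y \<in> carrier G" using cy BC FC by auto
    have "g \<otimes> e \<otimes> inv g = c \<otimes> (y \<otimes> e \<otimes> inv y) \<otimes> inv c"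
      using conjugate_mult[of c y e] C eC cy by simp
    also have "y \<otimes> e \<otimes> inv y = e" using cent[OF cy(2)] C eC by (metis inv_solve_right m_closed)
    finally show ?thesis using cy eB B by (simp add: subgroup.m_closed subgroup.m_inv_closed)
  qed
  then show ?thesis using eB ne by blast
qed

section \<open>A subgroup of index at most 2 in P with a larger normalizer\<close>

lemma (in group) large_normalizer:
  assumes fin: "finite (carrier G)" and P: "subgroup P G" and card: "card P = 2 ^ r"
    and idx: "card (rcosets P) mod 4 = 3"
  shows "\<exists>D. subgroup D G \<and> D \<subseteq> P \<and> card P \<le> 2 * card D \<and> P \<subset> normalizer G D"
proof -
  let ?P = "G\<lparr>carrier := P\<rparr>" and ?E = "rcosets P" and ?a = "coset_action G P"
  interpret A: group_action ?P ?E ?a by (rule coset_action_subgroup[OF P P])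
  have PC: "P \<subseteq> carrier G" using P by (rule subgroup.subset)
  have finP: "finite P" using PC fin finite_subset by blast
  have finE: "finite ?E" using fin P by (simp add: rcosets_finite RCOSETS_def)
  have "\<exists>R\<in>?E. R \<noteq> P \<and> card P \<le> 2 * card (stabilizer ?P ?a R)"
  proof (cases "\<forall>R\<in>?E. \<not> (\<forall>g\<in>carrier ?P. ?a g R = R) \<longrightarrow> 4 dvd card (orbit ?P ?a R)")
    \<comment> \<open>The number of fixed cosets is then 3 modulo 4, so some coset other than
      \<open>P\<close> is fixed.\<close>
    case True
    let ?F = "{R \<in> ?E. \<forall>g\<in>carrier ?P. ?a g R = R}"
    have "card ?F mod 4 = 3" using A.card_cong_card_fixed[OF finE, of 4] True idx by simp
    then have "\<not> card ?F \<le> 1" by auto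
    then have "\<not> ?F \<subseteq> {P}" using card_mono[of "{P}" ?F] by auto
    then obtain R where R: "R \<in> ?F" "R \<noteq> P" by blast
    then have "stabilizer ?P ?a R = P" by (auto simp: stabilizer_def)
    then show ?thesis using R by force
  next
    case False
    then obtain R where R: "R \<in> ?E" "\<not> (\<forall>g\<in>P. ?a g R = R)" "\<not> 4 dvd card (orbit ?P ?a R)"
      by auto
    have os: "card (orbit ?P ?a R) * card (stabilizer ?P ?a R) = 2 ^ r"
      using A.orbit_stabilizer_theorem[OF R(1)] card by (simp add: order_def)
    then obtain i where i: "card (orbit ?P ?a R) = 2 ^ i"
      using divides_primepow_nat[OF two_is_prime_nat] by (metis dvd_triv_left)
    \<comment> \<open>A power of 2 that 4 does not divide is 1 or 2, so the stabilizer has index at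
      most 2.\<close>
    have "\<not> 2 \<le> i"
      using R(3) i le_imp_power_dvd[of 2 i "2::nat"] by auto
    then have "card (orbit ?P ?a R) \<le> 2" unfolding i by (cases "i = 0") (auto simp: not_le less_Suc_eq numeral_2_eq_2)
    then have "card P \<le> 2 * card (stabilizer ?P ?a R)" using os card by (metis mult_le_mono1)
    moreover have "R \<noteq> P"
    proof
      assume "R = P"
      then have "?a g R = R" if "g \<in> P" for g
        using coset_action_fixes[OF P, of g \<one>] that PC by auto
      then show False using R(2) by blast
    qed
    ultimately show ?thesis using R(1) by blast
  qed
  then obtain x where x: "x \<in> carrier G" and ne: "P #> x \<noteq> P"
    and le: "card P \<le> 2 * card (stabilizer ?P ?a (P #> x))"
    by (auto simp: RCOSETS_def)
  have xP: "x \<notin> P" using ne coset_join2[OF x P] by blast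
  \<comment> \<open>\<open>D\<close> is the intersection of \<open>P\<close> with its conjugate
    \<open>Q\<close> by \<open>inv x\<close>, introduced below.\<close>
  define D where "D = stabilizer ?P ?a (P #> x)"
  have Dset: "D = {p \<in> P. x \<otimes> p \<otimes> inv x \<in> P}"
    unfolding D_def stabilizer_def using coset_action_fixes[OF P] x PC by auto
  have "P #> x \<in> ?E" using x PC by (simp add: rcosetsI)
  then have D: "subgroup D G"
    using incl_subgroup[OF P A.stabilizer_subgroup] by (simp add: D_def)
  define Q where "Q = (\<lambda>p. inv x \<otimes> p \<otimes> x) ` P"
  have Qeq: "Q = inv x <# P #> inv (inv x)"
    using x by (auto simp: Q_def l_coset_def r_coset_def)
  have Q: "subgroup Q G"
    unfolding Qeq using x P by (intro subgroup_conjugation_is_surj2) auto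
  have cQ: "card Q = card P"
    unfolding Q_def using x PC by (intro card_image inj_onI) (auto simp: subset_iff)
  have unconj: "inv x \<otimes> (x \<otimes> p \<otimes> inv x) \<otimes> x = p" if "p \<in> carrier G" for p
    using conjugate_mult[of "inv x" x p] x that by simp
  have unconj': "x \<otimes> (inv x \<otimes> p \<otimes> x) \<otimes> inv x = p" if "p \<in> carrier G" for p
    using conjugate_mult[of x "inv x" p] x that by simp
  have DQ: "D \<subseteq> Q"
  proof
    fix p assume "p \<in> D"
    then have "p = inv x \<otimes> (x \<otimes> p \<otimes> inv x) \<otimes> x" "x \<otimes> p \<otimes> inv x \<in> P"
      using unconj PC by (auto simp: Dset)
    then show "p \<in> Q" unfolding Q_def by blast
  qed
  \<comment> \<open>\<open>P\<close> and \<open>Q\<close> have the same order, so \<open>D\<close>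
    has index at most 2 in each of them and both normalize it.\<close>
  have norm: "y \<in> normalizer G D" if y: "y \<in> R" and R: "D \<subseteq> R" "subgroup R G" "card R = card P" for y R
  proof -
    have "finite R" using R(2) fin by (auto dest: subgroup.subset intro: finite_subset)
    then have "y \<otimes> d \<otimes> inv y \<in> D" if "d \<in> D" for d
      using index_2_conjugate[OF D R(2,1) _ _ y that] le R(3) by (simp add: D_def)
    then show ?thesis using normalizer_iff[OF fin D] subgroup.mem_carrier[OF R(2) y] by blast
  qed
  have PN: "P \<subseteq> normalizer G D" using norm[of _ P] P by (auto simp: Dset)
  have QN: "Q \<subseteq> normalizer G D" using norm[of _ Q] Q DQ cQ by auto
  \<comment> \<open>Equality would give \<open>Q = P\<close>, hence \<open>D = P\<close>. Then
    \<open>inv x\<close> normalizes \<open>D\<close> and so lies in \<open>P\<close>, against the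
    choice of \<open>x\<close>.\<close>
  have "P \<noteq> normalizer G D"
  proof
    assume eq: "P = normalizer G D"
    then have "Q = P" using QN cQ finP by (intro card_subset_eq) auto
    have "P \<subseteq> D"
    proof
      fix p assume p: "p \<in> P"
      then obtain q where "q \<in> P" "p = inv x \<otimes> q \<otimes> x" using \<open>Q = P\<close> Q_def by blast
      then have "x \<otimes> p \<otimes> inv x \<in> P" using unconj' PC by auto
      then show "p \<in> D" using p Dset by blast
    qed
    then have "D = P" using Dset by blast
    have "inv x \<in> normalizer G D"
      unfolding \<open>D = P\<close> normalizer_iff[OF fin P] using x \<open>Q = P\<close> Q_def by auto
    then have "inv x \<in> P" using eq by simp
    then have "x \<in> P" using subgroup.m_inv_closed[OF P, of "inv x"] x by simp
    then show False using xP by simp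
  qed
  then show ?thesis using D PN le Dset by (auto simp: D_def)
qed


section \<open>The permutation representation on the cosets of N\<close>

theorem theorem3p1:
  fixes G :: "('a, 'b) monoid_scheme" and r :: nat
  assumes "r \<ge> 4"
    and "group G"
    and "order G = 2 ^ r * 3 * 5"
  shows "p_core 2 G \<noteq> {\<one>\<^bsub>G\<^esub>}"
proof
  assume triv: "p_core 2 G = {\<one>\<^bsub>G\<^esub>}"
  interpret group G by fact
  have ord: "order G = 2 ^ r * 15" using assms(3) by simp
  have fin: "finite (carrier G)" using ord by (simp flip: order_gt_0_iff_finite)
  \<comment> \<open>This is applied twice: to the intersection of \<open>D\<close> with
    \<open>K\<close>, and in the last case to \<open>K\<close> itself.\<close>
  have no_core: "L = {\<one>\<^bsub>G\<^esub>}" if "K \<lhd> G" "normal_p_subgroup 2 L (G\<lparr>carrier := K\<rparr>)" for K L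
    using p_core_nontrivialI[OF fin two_is_prime_nat that] triv by blast
  obtain P where P: "subgroup P G" and cP: "card P = 2 ^ r"
    using sylow_thm[OF two_is_prime_nat group_axioms ord fin] by blast
  have "card (rcosets\<^bsub>G\<^esub> P) = 15" using lagrange[OF P] ord cP by simp
  then have "card (rcosets\<^bsub>G\<^esub> P) mod 4 = 3" by simp
  then obtain D where D: "subgroup D G" "D \<subseteq> P" and cPD: "card P \<le> 2 * card D"
    and PN: "P \<subset> normalizer G D"
    using large_normalizer[OF fin P cP] by blast
  define N where "N = normalizer G D"
  have N: "subgroup N G" unfolding N_def using D(1) by (simp add: normalizer_imp_subgroup subgroup.subset)
  have DN: "D \<subseteq> N" using D(2) PN by (auto simp: N_def)
  obtain s where s: "card D = 2 ^ s"
    using card_subgroup_dvd_card[OF D(1) P D(2)] cP divides_primepow_nat[OF two_is_prime_nat] by auto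
  have "(2::nat) ^ r \<le> 2 ^ Suc s" using cPD cP s by simp
  then have rs: "r \<le> Suc s" by (subst (asm) power_increasing_iff) auto
  define m where "m = card (rcosets\<^bsub>G\<^esub> N)"
  have mN: "m * card N = 2 ^ r * 15" using lagrange[OF N] ord by (simp add: m_def)
  have "card P dvd card N" using card_subgroup_dvd_card[OF P N] PN by (auto simp: N_def)
  then obtain k where k: "card N = 2 ^ r * k" using cP by auto
  have mk: "m * k = 15" using mN k by simp
  have "card P < card N"
    using PN N fin unfolding N_def by (metis psubset_card_mono finite_subset subgroup.subset)
  \<comment> \<open>\<open>k\<close> is the index of \<open>P\<close> in \<open>N\<close>; that it
    is not 1 excludes \<open>m = 15\<close>.\<close>
  then have "k \<noteq> 1" using k cP by auto
  then have m135: "m = 1 \<or> m = 3 \<or> m = 5"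
  proof -
    have "m dvd 15" using mk by (metis dvd_triv_left)
    then have "m \<le> 15" by (simp add: dvd_imp_le)
    then have "m = 0 \<or> m = 1 \<or> m = 2 \<or> m = 3 \<or> m = 4 \<or> m = 5 \<or> m = 6 \<or> m = 7 \<or> m = 8 \<or>
        m = 9 \<or> m = 10 \<or> m = 11 \<or> m = 12 \<or> m = 13 \<or> m = 14 \<or> m = 15" by arith
    then show ?thesis using \<open>m dvd 15\<close> mk \<open>k \<noteq> 1\<close> by (elim disjE) simp_all
  qed
  let ?B = "BijGroup (rcosets\<^bsub>G\<^esub> N)" and ?\<phi> = "coset_action G N"
  interpret h: group_hom G ?B ?\<phi>
    using coset_action_group_action[OF N] by (simp add: group_action_def)
  define K where "K = kernel G ?B ?\<phi>"
  have K: "K \<lhd> G" unfolding K_def by (rule h.normal_kernel)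
  have Ks: "subgroup K G" using K by (rule normal_imp_subgroup)
  have Kset: "K = {g \<in> carrier G. \<forall>x\<in>carrier G. x \<otimes>\<^bsub>G\<^esub> g \<otimes>\<^bsub>G\<^esub> inv\<^bsub>G\<^esub> x \<in> N}"
    unfolding K_def by (rule kernel_coset_action[OF N])
  have KN: "K \<subseteq> N"
  proof
    fix g assume "g \<in> K"
    then have "\<one>\<^bsub>G\<^esub> \<otimes>\<^bsub>G\<^esub> g \<otimes>\<^bsub>G\<^esub> inv\<^bsub>G\<^esub> \<one>\<^bsub>G\<^esub> \<in> N" "g \<in> carrier G" unfolding Kset by blast+
    then show "g \<in> N" by simp
  qed
  have DKs: "subgroup (D \<inter> K) G" using D(1) Ks by (rule subgroups_Inter_pair)
  have DK: "D \<inter> K = {\<one>\<^bsub>G\<^esub>}"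
  proof (rule no_core[OF K])
    interpret K: group "G\<lparr>carrier := K\<rparr>" using Ks by (rule subgroup_imp_group)
    have "D \<inter> K \<lhd> G\<lparr>carrier := K\<rparr>"
    proof (rule K.normal_invI)
      show "subgroup (D \<inter> K) (G\<lparr>carrier := K\<rparr>)" using DKs Ks by (rule subgroup_incl) simp
      fix x y assume xy: "x \<in> carrier (G\<lparr>carrier := K\<rparr>)" "y \<in> D \<inter> K"
      \<comment> \<open>Elements of \<open>K\<close> lie in \<open>N\<close> and so normalize
        \<open>D\<close>.\<close>
      then have "x \<in> N" using KN by auto
      then have "x \<otimes>\<^bsub>G\<^esub> y \<otimes>\<^bsub>G\<^esub> inv\<^bsub>G\<^esub> x \<in> D"
        using xy normalizer_iff[OF fin D(1)] by (simp add: N_def)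
      moreover have "x \<otimes>\<^bsub>G\<^esub> y \<otimes>\<^bsub>G\<^esub> inv\<^bsub>G\<^esub> x \<in> K"
        using xy Ks by (simp add: subgroup.m_closed subgroup.m_inv_closed)
      ultimately show "x \<otimes>\<^bsub>G\<lparr>carrier := K\<rparr>\<^esub> y \<otimes>\<^bsub>G\<lparr>carrier := K\<rparr>\<^esub> inv\<^bsub>G\<lparr>carrier := K\<rparr>\<^esub> x \<in> D \<inter> K"
        using xy by (simp add: m_inv_consistent[OF Ks])
    qed
    moreover have "card (D \<inter> K) dvd 2 ^ s"
      using card_subgroup_dvd_card[OF DKs D(1)] s by simp
    ultimately show "normal_p_subgroup 2 (D \<inter> K) (G\<lparr>carrier := K\<rparr>)"
      using divides_primepow_nat[OF two_is_prime_nat] by (auto simp: normal_p_subgroup_def)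
  qed
  have "kernel (G\<lparr>carrier := D\<rparr>) ?B ?\<phi> = D \<inter> K"
    using D(1) by (auto simp: K_def kernel_def dest: subgroup.mem_carrier)
  then have "inj_on ?\<phi> D" using h.inj_on_subgroup_iff_trivial_ker[OF D(1)] DK by simp
  then have cD': "card (?\<phi> ` D) = 2 ^ s" using s by (simp add: card_image)
  define I where "I = ?\<phi> ` carrier G"
  have Is: "subgroup I ?B" unfolding I_def by (rule h.img_is_subgroup)
  have D's: "subgroup (?\<phi> ` D) ?B" using D(1) by (rule h.subgroup_img_is_subgroup)
  have D'I: "?\<phi> ` D \<subseteq> I" using D(1) by (auto simp: I_def dest: subgroup.mem_carrier)
  have DI: "2 ^ s dvd card I" using h.H.card_subgroup_dvd_card[OF D's Is D'I] cD' by simp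
  have "finite (rcosets\<^bsub>G\<^esub> N)" using fin by (simp add: RCOSETS_def)
  then have Im: "card I dvd fact m"
    using h.H.card_subgroup_dvd_order[OF Is] card_carrier_BijGroup[of "rcosets\<^bsub>G\<^esub> N"]
    unfolding m_def order_def by metis
  have IK: "card I * card K = 2 ^ r * 15"
    using h.card_image_mult_card_kernel ord by (simp add: I_def K_def)
  \<comment> \<open>Now \<open>s\<close> is at least 3, and 8 divides neither 1! nor 3!, so
    \<open>m = 5\<close>. Since 16 does not divide 5! = 120, also \<open>s = 3\<close>, and then
    \<open>r\<close> is at most 4.\<close>
  have "2 ^ 3 dvd (2::nat) ^ s" using rs assms(1) by (intro le_imp_power_dvd) simp
  then have "8 dvd (2::nat) ^ s" by simp
  then have "8 dvd (fact m :: nat)" using DI Im by (meson dvd_trans)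
  then have m5: "m = 5" using m135 by (auto simp: fact_numeral)
  have "s = 3"
  proof (rule ccontr)
    assume "s \<noteq> 3"
    then have "2 ^ 4 dvd (2::nat) ^ s" using rs assms(1) by (intro le_imp_power_dvd) simp
    then have "2 ^ 4 dvd (fact m :: nat)" using DI Im by (meson dvd_trans)
    then have "16 dvd (120 :: nat)" using m5 by (simp add: fact_numeral)
    then show False by simp
  qed
  then have r4: "r = 4" using rs assms(1) by simp
  have "card K dvd 48"
    using card_subgroup_dvd_card[OF Ks N KN] mN m5 r4 by simp
  \<comment> \<open>\<open>q\<close> is the index of \<open>K\<close> in \<open>N\<close>, so the
    image \<open>I\<close> has order \<open>5 * q\<close>. This divides 120 and is divisible by 8,
    leaving 8 and 24 for \<open>q\<close>.\<close>
  then obtain q where q: "48 = card K * q" by blast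
  have "card K * card I = 5 * (card K * q)" unfolding q[symmetric] using IK r4 by (simp add: mult.commute)
  then have "card K = 0 \<or> card I = 5 * q" by simp
  moreover have "card K \<noteq> 0" using q by (intro notI) simp
  ultimately have Iq: "card I = 5 * q" by blast
  have "5 * q dvd 120" using Im m5 Iq by (simp add: fact_numeral)
  then have "5 * q dvd 5 * 24" by simp
  then have "q dvd 24" by (simp only: nat_mult_dvd_cancel_disj) simp
  have "8 dvd 5 * q" using DI \<open>s = 3\<close> Iq by simp
  then have "8 dvd q" by presburger
  then obtain j where j: "q = 8 * j" by blast
  then have "8 * j dvd 8 * 3" using \<open>q dvd 24\<close> by simp
  then have "j dvd 3" by (simp only: nat_mult_dvd_cancel_disj) simp
  then have "j = 1 \<or> j = 3" using prime_nat_iff[of 3] by simp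
  then consider "q = 8" | "q = 24" using j by fastforce
  then show False
  proof cases
    case 1
    interpret I: group "?B\<lparr>carrier := I\<rparr>" using Is by (rule h.H.subgroup_imp_group)
    have "order (?B\<lparr>carrier := I\<rparr>) = 40" using Iq 1 by (simp add: order_def)
    moreover have "subgroup (?\<phi> ` D) (?B\<lparr>carrier := I\<rparr>)"
      using D's Is D'I by (rule h.H.subgroup_incl)
    moreover have "card (?\<phi> ` D) = 8" using cD' \<open>s = 3\<close> by simp
    ultimately obtain d where d: "d \<in> D" "?\<phi> d \<noteq> \<one>\<^bsub>?B\<^esub>"
      and conj: "\<And>g. g \<in> I \<Longrightarrow> g \<otimes>\<^bsub>?B\<^esub> ?\<phi> d \<otimes>\<^bsub>?B\<^esub> inv\<^bsub>?B\<lparr>carrier := I\<rparr>\<^esub> g \<in> ?\<phi> ` D"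
      using I.order_40_core by force
    have dC: "d \<in> carrier G" using d(1) D(1) by (rule subgroup.mem_carrier[rotated])
    have "x \<otimes>\<^bsub>G\<^esub> d \<otimes>\<^bsub>G\<^esub> inv\<^bsub>G\<^esub> x \<in> N" if x: "x \<in> carrier G" for x
    proof -
      let ?y = "x \<otimes>\<^bsub>G\<^esub> d \<otimes>\<^bsub>G\<^esub> inv\<^bsub>G\<^esub> x"
      have xI: "?\<phi> x \<in> I" using x by (simp add: I_def)
      have "?\<phi> ?y = ?\<phi> x \<otimes>\<^bsub>?B\<^esub> ?\<phi> d \<otimes>\<^bsub>?B\<^esub> inv\<^bsub>?B\<lparr>carrier := I\<rparr>\<^esub> (?\<phi> x)"
        using x dC h.H.m_inv_consistent[OF Is xI] by simp
      then obtain c where c: "c \<in> D" "?\<phi> ?y = ?\<phi> c" using conj[OF xI] by auto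
      have cC: "c \<in> carrier G" using c(1) D(1) by (rule subgroup.mem_carrier[rotated])
      \<comment> \<open>\<open>?y\<close> and \<open>c\<close> have the same image, so they differ
        by an element of \<open>K\<close>, which lies in \<open>N\<close>; as \<open>c\<close> is in
        \<open>D\<close> and hence in \<open>N\<close>, so is \<open>?y\<close>. All conjugates of
        \<open>d\<close> being in \<open>N\<close>, \<open>d\<close> falls into the kernel although
        its image is nontrivial.\<close>
      have "?\<phi> (?y \<otimes>\<^bsub>G\<^esub> inv\<^bsub>G\<^esub> c) = \<one>\<^bsub>?B\<^esub>"
        using c(2) x dC cC by (simp del: h.hom_mult add: h.hom_mult[of ?y "inv\<^bsub>G\<^esub> c"])
      then have "?y \<otimes>\<^bsub>G\<^esub> inv\<^bsub>G\<^esub> c \<in> N"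
        using x dC cC KN by (auto simp: K_def kernel_def subset_iff)
      then have "?y \<otimes>\<^bsub>G\<^esub> inv\<^bsub>G\<^esub> c \<otimes>\<^bsub>G\<^esub> c \<in> N" using c(1) DN N by (blast intro: subgroup.m_closed)
      then show ?thesis using x dC cC by (simp add: m_assoc)
    qed
    then have "d \<in> K" using dC by (simp add: Kset)
    then show False using d(2) by (simp add: K_def kernel_def)
  next
    case 2
    then have "card K = 2" using q by simp
    then have "normal_p_subgroup 2 K (G\<lparr>carrier := K\<rparr>)"
      using group.normal_self[OF subgroup_imp_group[OF Ks]] 
      by (auto simp: normal_p_subgroup_def intro!: exI[of _ 1])
    then show False using no_core[OF K] \<open>card K = 2\<close> by fastforce
  qed
qed

end
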